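(* Let $N,d\ge 1$, let $A^{(l)}\in\mathbb{R}^{N\times N}$ and $W^{(l)}\in\mathbb{R}^{d\times d}$ for $l\ge 0$, let $\sigma:\mathbb{R}^N\to\mathbb{R}^N$, and let $X^{(0)}\in\mathbb{R}^{N\times d}$. Define $X^{(l+1)}=\sigma(A^{(l)}X^{(l)}W^{(l)})$ for $l\ge 0$, where $\sigma$ is applied to each column of the matrix. Assume that there is a vector $u\in\mathbb{R}^N$ with $\|u\|_2=1$ which is a dominant eigenvector of $A^{(l)}$ for every $l$ and which is also an eigenvector of the activation $\sigma$. Let $\mathcal{P}=uu^\top$. If $\sigma$ is $1$-Lipschitz, i.e. $\|\sigma(x)-\sigma(y)\|_2\le\|x-y\|_2$ for all $x,y\in\mathbb{R}^N$, and $$\lim_{L\to\infty}\prod_{l=0}^{L}\|(I-\mathcal{P})A^{(l)}\|_2\,\|W^{(l)}\|_2=0,$$ then $$E_{\mathrm{Proj}}(X^{(L)})\to 0\quad\text{as } L\to\infty.$$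
   Context: A dominant eigenvector of a square matrix $A$ is an eigenvector associated with an eigenvalue of largest modulus. A vector $u\in\mathbb{R}^N\setminus\{0\}$ is called an eigenvector of the (nonlinear) map $\sigma:\mathbb{R}^N\to\mathbb{R}^N$ if for every $t\in\mathbb{R}\setminus\{0\}$ there exists $\mu_t\in\mathbb{R}$ such that $\sigma(tu)=\mu_t u$. For $X\in\mathbb{R}^{N\times d}$, $E_{\mathrm{Proj}}(X)=\|X-\mathcal{P}X\|_F^2$, where $\|\cdot\|_F$ is the Frobenius norm. $\|\cdot\|_2$ of a matrix is the spectral norm and of a vector the Euclidean norm. *)

theory Defs
  imports "HOL-Analysis.Analysis"
begin

definition eigenpair :: "'a::field^'n^'n \<Rightarrow> 'a \<Rightarrow> 'a^'n \<Rightarrow> bool" where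
  "eigenpair A c v \<longleftrightarrow> v \<noteq> 0 \<and> A *v v = c *s v"

definition is_eigenvalue :: "'a::field^'n^'n \<Rightarrow> 'a \<Rightarrow> bool" where
  "is_eigenvalue A c \<longleftrightarrow> (\<exists>v. eigenpair A c v)"

(* The modulus is maximal among all complex eigenvalues of the real matrix, not only the
   real ones.  The eigenvalue belonging to a real eigenvector is necessarily real. *)
definition dominant_eigenvector :: "real^'n^'n \<Rightarrow> real^'n \<Rightarrow> bool" where
  "dominant_eigenvector A v \<longleftrightarrow>
     (\<exists>c. eigenpair A c v \<and>
          (\<forall>\<mu>. is_eigenvalue (map_matrix complex_of_real A) \<mu> \<longrightarrow> cmod \<mu> \<le> \<bar>c\<bar>))"

(* t = 0 is excluded, so nothing is said about the value at the origin. *)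
definition map_eigenvector :: "(real^'n \<Rightarrow> real^'n) \<Rightarrow> real^'n \<Rightarrow> bool" where
  "map_eigenvector \<sigma> u \<longleftrightarrow>
     u \<noteq> 0 \<and> (\<forall>t. t \<noteq> 0 \<longrightarrow> (\<exists>\<mu>. \<sigma> (t *\<^sub>R u) = \<mu> *\<^sub>R u))"

(* An N x d matrix X has type real^'d^'n, and X $ i $ j is the entry in row i, column j. *)
definition map_columns :: "(real^'n \<Rightarrow> real^'n) \<Rightarrow> real^'d^'n \<Rightarrow> real^'d^'n" where
  "map_columns \<sigma> X = (\<chi> i j. \<sigma> (column j X) $ i)"

primrec features :: "(real^'n \<Rightarrow> real^'n) \<Rightarrow> (nat \<Rightarrow> real^'n^'n) \<Rightarrow> (nat \<Rightarrow> real^'d^'d)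
    \<Rightarrow> real^'d^'n \<Rightarrow> nat \<Rightarrow> real^'d^'n" where
  "features \<sigma> A W X0 0 = X0"
| "features \<sigma> A W X0 (Suc l) = map_columns \<sigma> (A l ** features \<sigma> A W X0 l ** W l)"

definition outer_square :: "real^'n \<Rightarrow> real^'n^'n" where
  "outer_square u = (\<chi> i j. u $ i * u $ j)"

definition frobenius_norm :: "real^'d^'n \<Rightarrow> real" where
  "frobenius_norm X = sqrt (\<Sum>i\<in>UNIV. \<Sum>j\<in>UNIV. (X $ i $ j)\<^sup>2)"

(* onorm is the operator norm with respect to the Euclidean vector norms. *)
definition spectral_norm :: "real^'d^'n \<Rightarrow> real" where
  "spectral_norm M = onorm ((*v) M)"

definition E_Proj :: "real^'n^'n \<Rightarrow> real^'d^'n \<Rightarrow> real" where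
  "E_Proj P X = (frobenius_norm (X - P ** X))\<^sup>2"

end

theory Submission
  imports Defs
begin

text \<open>Fix a unit vector \<open>u\<close> and let \<open>P = u u\<^sup>T\<close>, \<open>Q = I - P\<close>. For every \<open>x\<close>, the vector \<open>\<sigma> (P x)\<close> lies on the line
  through \<open>u\<close>, and \<open>Q (\<sigma> x)\<close> is the distance vector from \<open>\<sigma> x\<close> to that line; hence
  \<open>\<parallel>Q (\<sigma> x)\<parallel> \<le> \<parallel>\<sigma> x - \<sigma> (P x)\<parallel> \<le> \<parallel>Q x\<parallel>\<close>, so applying \<open>\<sigma>\<close> does not increase \<open>\<parallel>Q X\<parallel>\<close>. Since \<open>u\<close> is an
  eigenvector of \<open>A\<close>, one has \<open>Q A = Q A Q\<close>, and a layer therefore multiplies \<open>\<parallel>Q X\<parallel>\<close> by at most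
  \<open>\<parallel>Q A\<parallel> \<parallel>W\<parallel>\<close>.\<close>

lemma frobenius_norm_eq_norm: "frobenius_norm X = norm X"
  unfolding frobenius_norm_def norm_vec_def L2_set_def
  by (simp add: real_sqrt_pow2 sum_nonneg)

lemma frobenius_norm_sq_columns:
  "(frobenius_norm (X :: real^'d^'n))\<^sup>2 = (\<Sum>j\<in>UNIV. (norm (column j X))\<^sup>2)"
proof -
  have "(frobenius_norm X)\<^sup>2 = (\<Sum>i\<in>UNIV. \<Sum>j\<in>UNIV. (X $ i $ j)\<^sup>2)"
    unfolding frobenius_norm_def by (simp add: real_sqrt_pow2 sum_nonneg)
  also have "\<dots> = (\<Sum>j\<in>UNIV. \<Sum>i\<in>UNIV. (X $ i $ j)\<^sup>2)"
    by (rule sum.swap)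
  also have "\<dots> = (\<Sum>j\<in>UNIV. (norm (column j X))\<^sup>2)"
    unfolding norm_vec_def L2_set_def by (simp add: column_def sum_nonneg)
  finally show ?thesis .
qed

text \<open>Left multiplication and \<open>map_columns\<close> both act column by column, so this
  reduces their Frobenius estimates to estimates for single vectors.\<close>

lemma frobenius_norm_le_columns:
  fixes X :: "real^'d^'n" and Y :: "real^'d^'m"
  assumes "0 \<le> c" and "\<And>j. norm (column j X) \<le> c * norm (column j Y)"
  shows "frobenius_norm X \<le> c * frobenius_norm Y"
proof (rule power2_le_imp_le)
  have "(norm (column j X))\<^sup>2 \<le> c\<^sup>2 * (norm (column j Y))\<^sup>2" for j
    using power_mono[OF assms(2)[of j] norm_ge_zero, of 2] by (simp add: power_mult_distrib)
  then show "(frobenius_norm X)\<^sup>2 \<le> (c * frobenius_norm Y)\<^sup>2"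
    unfolding power_mult_distrib frobenius_norm_sq_columns sum_distrib_left by (rule sum_mono)
  show "0 \<le> c * frobenius_norm Y"
    using assms(1) by (simp add: frobenius_norm_eq_norm)
qed

lemma column_matrix_matrix_mult: "column j (M ** X) = M *v column j X"
  by (simp add: vec_eq_iff column_def matrix_matrix_mult_def matrix_vector_mult_def)

lemma spectral_norm_nonneg: "0 \<le> spectral_norm M"
  unfolding spectral_norm_def by (rule onorm_pos_le[OF matrix_vector_mul_bounded_linear])

lemma norm_matrix_vector_mult_le: "norm (M *v x) \<le> spectral_norm M * norm x"
  unfolding spectral_norm_def by (rule onorm[OF matrix_vector_mul_bounded_linear])

text \<open>Transposing does not increase the operator norm: in the inner product of
  \<open>x v* M\<close> with itself, one copy of \<open>M\<close> moves to the other side,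
  Cauchy-Schwarz applies, and a factor \<open>norm (x v* M)\<close> cancels.\<close>

lemma norm_vector_matrix_mult_le: "norm (x v* M) \<le> spectral_norm M * norm x"
  for M :: "real^'d^'n"
proof (cases "x v* M = 0")
  case True
  then show ?thesis by (simp add: spectral_norm_nonneg)
next
  case False
  have "norm (x v* M) * norm (x v* M) = x \<bullet> (M *v (x v* M))"
    by (metis dot_lmul_matrix power2_eq_square power2_norm_eq_inner)
  also have "\<dots> \<le> norm x * norm (M *v (x v* M))"
    by (rule norm_cauchy_schwarz)
  also have "\<dots> \<le> norm x * (spectral_norm M * norm (x v* M))"
    by (intro mult_left_mono norm_matrix_vector_mult_le norm_ge_zero)
  finally have "norm (x v* M) * norm (x v* M) \<le> (spectral_norm M * norm x) * norm (x v* M)"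
    by (simp add: algebra_simps)
  with False show ?thesis by simp
qed

lemma frobenius_norm_mult_left: "frobenius_norm (M ** X) \<le> spectral_norm M * frobenius_norm X"
  by (rule frobenius_norm_le_columns)
    (simp_all add: column_matrix_matrix_mult norm_matrix_vector_mult_le spectral_norm_nonneg)

lemma frobenius_norm_mult_right: "frobenius_norm (X ** M) \<le> frobenius_norm X * spectral_norm M"
  for X :: "real^'k^'n" and M :: "real^'d^'k"
proof -
  \<comment> \<open>Right multiplication mixes the columns but acts on each row separately, so here
    the Frobenius norm is read as the \<open>L2_set\<close> of the row norms.\<close>
  have row: "(X ** M) $ i = X $ i v* M" for i
    by (simp add: vec_eq_iff matrix_matrix_mult_def vector_matrix_mult_def mult.commute)
  have "frobenius_norm (X ** M) \<le> L2_set (\<lambda>i. spectral_norm M * norm (X $ i)) UNIV"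
    unfolding frobenius_norm_eq_norm norm_vec_def[of "X ** M"] row
    by (rule L2_set_mono) (simp_all add: norm_vector_matrix_mult_le)
  also have "\<dots> = spectral_norm M * frobenius_norm X"
    by (simp add: L2_set_right_distrib[symmetric] spectral_norm_nonneg frobenius_norm_eq_norm norm_vec_def)
  finally show ?thesis by (simp add: mult.commute)
qed

lemma outer_square_mult: "outer_square u *v x = (u \<bullet> x) *\<^sub>R u"
  by (simp add: vec_eq_iff outer_square_def matrix_vector_mult_def inner_vec_def sum_distrib_left
      mult_ac)

lemma compl_outer_square_mult: "(mat 1 - outer_square u) *v x = x - (u \<bullet> x) *\<^sub>R u"
  by (simp add: matrix_vector_mult_diff_rdistrib outer_square_mult)

lemma compl_outer_square_mult_self:
  "norm u = 1 \<Longrightarrow> (mat 1 - outer_square u) *v (c *\<^sub>R u) = 0"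
  by (simp add: compl_outer_square_mult dot_square_norm)

text \<open>Pythagoras: \<open>(u \<bullet> x) *\<^sub>R u\<close> is the orthogonal projection of
  \<open>x\<close> to the line through \<open>u\<close>, and removing it subtracts its squared
  length.\<close>

lemma norm_compl_outer_square_le:
  assumes "norm u = 1"
  shows "norm ((mat 1 - outer_square u) *v x) \<le> norm x"
proof (rule power2_le_imp_le)
  have "u \<bullet> u = 1"
    using assms by (simp add: dot_square_norm)
  then have "(norm (x - (u \<bullet> x) *\<^sub>R u))\<^sup>2 = (norm x)\<^sup>2 - (u \<bullet> x)\<^sup>2"
    unfolding power2_norm_eq_inner
    by (simp add: inner_diff_left inner_diff_right inner_commute power2_eq_square)
  then show "(norm ((mat 1 - outer_square u) *v x))\<^sup>2 \<le> (norm x)\<^sup>2"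
    by (simp add: compl_outer_square_mult)
qed simp

text \<open>The definition of a map eigenvector says nothing about \<open>t = 0\<close>; that case follows by continuity
  because a line is closed.\<close>

lemma map_eigenvector_span:
  fixes \<sigma> :: "real^'n \<Rightarrow> real^'n"
  assumes "map_eigenvector \<sigma> u" and "continuous_on UNIV \<sigma>"
  shows "\<sigma> (t *\<^sub>R u) \<in> span {u}"
proof (cases "t = 0")
  case False
  then show ?thesis
    using assms(1) by (metis map_eigenvector_def span_mul span_base singletonI)
next
  case True
  have "((\<lambda>s. \<sigma> (s *\<^sub>R u)) \<longlongrightarrow> \<sigma> (0 *\<^sub>R u)) (at (0::real))"
    using assms(2) by (intro isCont_tendsto_compose[of _ \<sigma>] tendsto_intros)
      (simp add: continuous_on_eq_continuous_at)
  \<comment> \<open>The filter \<open>at 0\<close> omits the point 0 itself, so the eigenvector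
    condition covers every \<open>s\<close> that counts.\<close>
  moreover have "\<forall>\<^sub>F s in at (0::real). \<sigma> (s *\<^sub>R u) \<in> span {u}"
    using assms(1) unfolding eventually_at_filter map_eigenvector_def
    by (metis (mono_tags, lifting) always_eventually span_mul span_base singletonI)
  ultimately have "\<sigma> (0 *\<^sub>R u) \<in> span {u}"
    by (intro Lim_in_closed_set[OF closed_span]) auto
  with True show ?thesis by simp
qed

lemma norm_compl_outer_square_activation_le:
  fixes \<sigma> :: "real^'n \<Rightarrow> real^'n"
  assumes "norm u = 1" and "map_eigenvector \<sigma> u"
    and lip: "\<And>x y. norm (\<sigma> x - \<sigma> y) \<le> norm (x - y)"
  shows "norm ((mat 1 - outer_square u) *v \<sigma> x) \<le> norm ((mat 1 - outer_square u) *v x)"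
proof -
  let ?Q = "mat 1 - outer_square u" and ?y = "(u \<bullet> x) *\<^sub>R u"
  have "1-lipschitz_on UNIV \<sigma>"
    using lip by (intro lipschitz_onI) (simp_all add: dist_norm)
  then have "\<sigma> ?y \<in> span {u}"
    using assms(2) lipschitz_on_continuous_on by (intro map_eigenvector_span)
  \<comment> \<open>Since \<open>?Q\<close> kills the line through \<open>u\<close>,
    \<open>\<sigma> ?y\<close> can be subtracted under \<open>?Q\<close> for free, which brings in
    the Lipschitz bound.\<close>
  then have "?Q *v \<sigma> ?y = 0"
    using compl_outer_square_mult_self[OF assms(1)] by (auto simp: span_singleton)
  then have "norm (?Q *v \<sigma> x) = norm (?Q *v (\<sigma> x - \<sigma> ?y))"
    by (simp add: matrix_vector_mult_diff_distrib)
  also have "\<dots> \<le> norm (\<sigma> x - \<sigma> ?y)"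
    by (rule norm_compl_outer_square_le[OF assms(1)])
  also have "\<dots> \<le> norm (x - ?y)"
    by (rule lip)
  finally show ?thesis by (simp only: compl_outer_square_mult)
qed

lemma frobenius_norm_map_columns_le:
  fixes \<sigma> :: "real^'n \<Rightarrow> real^'n" and X :: "real^'d^'n"
  assumes "norm u = 1" and "map_eigenvector \<sigma> u"
    and "\<And>x y. norm (\<sigma> x - \<sigma> y) \<le> norm (x - y)"
  shows "frobenius_norm ((mat 1 - outer_square u) ** map_columns \<sigma> X)
    \<le> frobenius_norm ((mat 1 - outer_square u) ** X)"
proof -
  have "column j (map_columns \<sigma> X) = \<sigma> (column j X)" for j
    by (simp add: vec_eq_iff map_columns_def column_def)
  then show ?thesis
    using norm_compl_outer_square_activation_le[OF assms]
    by (intro frobenius_norm_le_columns[where c = 1, simplified])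
      (simp add: column_matrix_matrix_mult)
qed

text \<open>\<open>A\<close> maps the line through \<open>u\<close> into itself and
  \<open>?Q\<close> kills that line, so the component of a vector along \<open>u\<close> contributes
  nothing to \<open>?Q ** A\<close>.\<close>

lemma compl_outer_square_mult_eigen:
  assumes "norm u = 1" and "eigenpair A c u"
  shows "(mat 1 - outer_square u) ** A =
    (mat 1 - outer_square u) ** A ** (mat 1 - outer_square u)"
proof -
  let ?Q = "mat 1 - outer_square u"
  have "?Q *v (A *v u) = 0"
    using assms compl_outer_square_mult_self[OF assms(1), of c]
    by (simp add: eigenpair_def scalar_mult_eq_scaleR)
  then have "?Q ** A ** ?Q *v x = ?Q ** A *v x" for x
    by (simp add: compl_outer_square_mult[of u x] matrix_vector_mult_diff_distrib
        matrix_vector_mult_scaleR flip: matrix_vector_mul_assoc)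
  then show ?thesis by (simp add: matrix_eq)
qed

lemma frobenius_norm_layer_le:
  fixes \<sigma> :: "real^'n \<Rightarrow> real^'n" and X :: "real^'d^'n" and A :: "real^'n^'n" and W :: "real^'d^'d"
  assumes "norm u = 1" and "eigenpair A c u" and "map_eigenvector \<sigma> u"
    and "\<And>x y. norm (\<sigma> x - \<sigma> y) \<le> norm (x - y)"
  defines "Q \<equiv> mat 1 - outer_square u"
  shows "frobenius_norm (Q ** map_columns \<sigma> (A ** X ** W))
    \<le> spectral_norm (Q ** A) * spectral_norm W * frobenius_norm (Q ** X)"
proof -
  have "frobenius_norm (Q ** map_columns \<sigma> (A ** X ** W)) \<le> frobenius_norm (Q ** (A ** X ** W))"
    unfolding Q_def by (rule frobenius_norm_map_columns_le[OF assms(1,3,4)])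
  \<comment> \<open>The extra \<open>Q\<close> makes the bound refer to \<open>Q ** X\<close>, the
    same quantity one layer earlier, so that it can be iterated.\<close>
  also have "Q ** (A ** X ** W) = Q ** A ** (Q ** X) ** W"
    using compl_outer_square_mult_eigen[OF assms(1,2)]
    by (simp add: matrix_mul_assoc flip: Q_def)
  also have "frobenius_norm \<dots> \<le> frobenius_norm (Q ** A ** (Q ** X)) * spectral_norm W"
    by (rule frobenius_norm_mult_right)
  also have "\<dots> \<le> spectral_norm (Q ** A) * frobenius_norm (Q ** X) * spectral_norm W"
    by (intro mult_right_mono frobenius_norm_mult_left spectral_norm_nonneg)
  finally show ?thesis by (simp add: mult_ac)
qed

theorem theorem3p2:
  fixes A :: "nat \<Rightarrow> real^'n^'n"
    and W :: "nat \<Rightarrow> real^'d^'d"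
    and \<sigma> :: "real^'n \<Rightarrow> real^'n"
    and X0 :: "real^'d^'n"
    and u :: "real^'n"
    and P :: "real^'n^'n"
  assumes "norm u = 1"
    and "\<And>l. dominant_eigenvector (A l) u"
    and "map_eigenvector \<sigma> u"
    and "P = outer_square u"
    and "\<And>x y. norm (\<sigma> x - \<sigma> y) \<le> norm (x - y)"
    and "(\<lambda>L. \<Prod>l\<le>L. spectral_norm ((mat 1 - P) ** A l) * spectral_norm (W l)) \<longlonglongrightarrow> 0"
  shows "(\<lambda>L. E_Proj P (features \<sigma> A W X0 L)) \<longlonglongrightarrow> 0"
proof -
  define Q where "Q = mat 1 - P"
  define a where "a l = spectral_norm (Q ** A l) * spectral_norm (W l)" for l
  let ?F = "\<lambda>L. frobenius_norm (Q ** features \<sigma> A W X0 L)"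
  have step: "?F (Suc l) \<le> a l * ?F l" for l
    using assms(2)[of l] frobenius_norm_layer_le[OF assms(1) _ assms(3,5)]
    unfolding dominant_eigenvector_def a_def Q_def assms(4) by auto
  \<comment> \<open>Layers 0 to \<open>L\<close> are \<open>Suc L\<close> many, hence the shift
    between the feature index and the product.\<close>
  have bound: "?F (Suc L) \<le> (\<Prod>l\<le>L. a l) * ?F 0" for L
  proof (induction L)
    case 0
    show ?case using step[of 0] by simp
  next
    case (Suc L)
    have "?F (Suc (Suc L)) \<le> a (Suc L) * ?F (Suc L)"
      by (rule step)
    also have "\<dots> \<le> a (Suc L) * ((\<Prod>l\<le>L. a l) * ?F 0)"
      by (intro mult_left_mono Suc.IH) (simp add: a_def spectral_norm_nonneg)
    finally show ?case by (simp add: mult_ac)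
  qed
  have "(\<lambda>L. (\<Prod>l\<le>L. a l) * ?F 0) \<longlonglongrightarrow> 0"
    using assms(6) unfolding a_def Q_def by (rule tendsto_mult_left_zero)
  \<comment> \<open>Squeeze between 0 and the product bound; \<open>features.simps\<close> stays
    folded so that \<open>bound\<close> matches.\<close>
  then have "(\<lambda>L. ?F (Suc L)) \<longlonglongrightarrow> 0"
    by (rule Lim_null_comparison[rotated])
      (use bound in \<open>simp add: frobenius_norm_eq_norm del: features.simps\<close>)
  then have "?F \<longlonglongrightarrow> 0"
    by (rule LIMSEQ_imp_Suc)
  then have "(\<lambda>L. (?F L)\<^sup>2) \<longlonglongrightarrow> 0"
    using tendsto_power[of ?F 0 sequentially 2] by simp
  \<comment> \<open>This identifies \<open>E_Proj\<close> with the square of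
    \<open>?F\<close>.\<close>
  moreover have "X - P ** X = Q ** X" for X :: "real^'d^'n"
    unfolding Q_def matrix_eq
    by (simp add: matrix_vector_mult_diff_rdistrib flip: matrix_vector_mul_assoc)
  ultimately show ?thesis
    by (simp add: E_Proj_def)
qed

end
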